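(* Let $\mathfrak{g}$ be a Lie algebra over a field $\mathbb{F}$ of characteristic $2$ which has a $1$-dimensional ideal $\mathfrak{h}$. Let $\mathbb{F}_1$ be a $1$-dimensional $\mathfrak{g}$-module on which $\mathfrak{h}$ acts non-trivially, i.e. some generator $x$ of $\mathfrak{h}$ acts by $x\cdot v=v$ for all $v\in\mathbb{F}_1$. Then $$HS^\bullet(\mathfrak{g},\mathbb{F}_1)=HL^\bullet(\mathfrak{g},\mathbb{F}_1)=H^\bullet(\mathfrak{g},\mathbb{F}_1)=0,$$ i.e. all three cohomologies vanish in every degree $n\ge 0$ (for $HL^\bullet$, $\mathbb{F}_1$ is considered as a symmetric Leibniz $\mathfrak{g}$-bimodule).
   Context: Let $\mathbb{F}$ be a field of characteristic $2$. A Lie algebra over $\mathbb{F}$ has a bilinear bracket with $[x,x]=0$ for all $x$ (hence $[x,y]=[y,x]$) and the Jacobi identity. A $\mathfrak{g}$-module is a vector space $M$ with a bilinear action satisfying $[x,y]\cdot m=x\cdot(y\cdot m)+y\cdot(x\cdot m)$. Commutative cohomology $HS^\bullet(\mathfrak{g},M)$ is the cohomology of $CS^n(\mathfrak{g},M):=\mathrm{Hom}_{\mathbb{F}}(S^n\mathfrak{g},M)$, where $S^n\mathfrak{g}$ is the $n$-th symmetric power (quotient of $\mathfrak{g}^{\otimes n}$), with differential $$d^nf(x_1,\dots,x_{n+1})=\sum_{i=1}^{n+1}x_i\cdot f(x_1,\dots,\hat{x}_i,\dots,x_{n+1})+\sum_{1\le i<j\le n+1}f([x_i,x_j],x_1,\dots,\hat{x}_i,\dots,\hat{x}_j,\dots,x_{n+1}).$$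 Chevalley–Eilenberg cohomology $H^\bullet(\mathfrak{g},M)$ is the cohomology of $C^n(\mathfrak{g},M):=\mathrm{Hom}_{\mathbb{F}}(\Lambda^n\mathfrak{g},M)$ with the same formula for $d$, where $\Lambda^n\mathfrak{g}$ is the usual exterior power (cochains vanish when two arguments are equal). Leibniz cohomology $HL^\bullet(\mathfrak{g},M)$ with values in $M$ considered as a symmetric bimodule (right action $m\cdot x=x\cdot m$; signs are irrelevant in characteristic $2$) is the cohomology of $CL^n(\mathfrak{g},M):=\mathrm{Hom}_{\mathbb{F}}(\mathfrak{g}^{\otimes n},M)$ with $$d^nf(x_1,\dots,x_{n+1})=\sum_{i=1}^{n+1}x_i\cdot f(x_1,\dots,\hat{x}_i,\dots,x_{n+1})+\sum_{1\le i<j\le n+1}f(x_1,\dots,\hat{x}_i,\dots,[x_i,x_j],\dots,x_{n+1}),$$ where $[x_i,x_j]$ stands in the place of $x_j$. *)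

theory Defs
  imports "HOL-Computational_Algebra.Computational_Algebra" "HOL-Library.Multiset"
begin

locale char2_lie_algebra = vector_space sg
  for sg :: "'k::field \<Rightarrow> 'g::ab_group_add \<Rightarrow> 'g" +
  fixes br :: "'g \<Rightarrow> 'g \<Rightarrow> 'g"
  assumes char2: "CHAR('k) = 2"
    and br_linear_left: "\<And>y. Vector_Spaces.linear sg sg (\<lambda>x. br x y)"
    and br_linear_right: "\<And>x. Vector_Spaces.linear sg sg (br x)"
    and br_self: "\<And>x. br x x = 0"
    and jacobi: "\<And>x y z. br x (br y z) + br y (br z x) + br z (br x y) = 0"

locale char2_lie_module =
  char2_lie_algebra sg br + mod: vector_space sm
  for sg :: "'k::field \<Rightarrow> 'g::ab_group_add \<Rightarrow> 'g"
    and br :: "'g \<Rightarrow> 'g \<Rightarrow> 'g"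
    and sm :: "'k \<Rightarrow> 'm::ab_group_add \<Rightarrow> 'm" +
  fixes act :: "'g \<Rightarrow> 'm \<Rightarrow> 'm"
  assumes act_linear_left: "\<And>m. Vector_Spaces.linear sg sm (\<lambda>x. act x m)"
    and act_linear_right: "\<And>x. Vector_Spaces.linear sm sm (act x)"
    and act_br: "\<And>x y m. act (br x y) m = act x (act y m) + act y (act x m)"

text \<open>The bracket is alternating, so there is no difference between left and right ideals.\<close>

definition lie_ideal ::
  "('k::field \<Rightarrow> 'g::ab_group_add \<Rightarrow> 'g) \<Rightarrow> ('g \<Rightarrow> 'g \<Rightarrow> 'g) \<Rightarrow> 'g set \<Rightarrow> bool" where
  "lie_ideal sg br h \<longleftrightarrow> module.subspace sg h \<and> (\<forall>x. \<forall>y\<in>h. br x y \<in> h)"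

text \<open>
  A linear map from the n-th tensor power is given, as usual, by its values on the decomposable
  tensors, that is, by an n-linear map, here a function on the lists of length n. Functions are
  made zero on lists of any other length, so that equality of cochains is equality of functions.
  Linear maps from the symmetric and the exterior power are the n-linear maps that
  factor through the respective quotient of the tensor power.
\<close>

definition tensor_cochains ::
  "('k::field \<Rightarrow> 'g::ab_group_add \<Rightarrow> 'g) \<Rightarrow> ('k \<Rightarrow> 'm::ab_group_add \<Rightarrow> 'm)
    \<Rightarrow> nat \<Rightarrow> ('g list \<Rightarrow> 'm) set" where
  "tensor_cochains sg sm n = {f.
     (\<forall>xs. length xs \<noteq> n \<longrightarrow> f xs = 0) \<and>
     (\<forall>xs i. length xs = n \<longrightarrow> i < n \<longrightarrow> Vector_Spaces.linear sg sm (\<lambda>y. f (xs[i := y])))}"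

definition symmetric_cochains ::
  "('k::field \<Rightarrow> 'g::ab_group_add \<Rightarrow> 'g) \<Rightarrow> ('k \<Rightarrow> 'm::ab_group_add \<Rightarrow> 'm)
    \<Rightarrow> nat \<Rightarrow> ('g list \<Rightarrow> 'm) set" where
  "symmetric_cochains sg sm n =
     {f \<in> tensor_cochains sg sm n. \<forall>xs ys. mset xs = mset ys \<longrightarrow> f xs = f ys}"

definition alternating_cochains ::
  "('k::field \<Rightarrow> 'g::ab_group_add \<Rightarrow> 'g) \<Rightarrow> ('k \<Rightarrow> 'm::ab_group_add \<Rightarrow> 'm)
    \<Rightarrow> nat \<Rightarrow> ('g list \<Rightarrow> 'm) set" where
  "alternating_cochains sg sm n =
     {f \<in> tensor_cochains sg sm n. \<forall>xs. \<not> distinct xs \<longrightarrow> f xs = 0}"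

definition omit :: "nat \<Rightarrow> 'a list \<Rightarrow> 'a list" where
  "omit i xs = take i xs @ drop (Suc i) xs"

text \<open>
  List positions count from 0. The differentials do not mention the degree: on a cochain of
  degree n, all summands vanish at lists of length other than n + 1.
\<close>

definition CE_diff ::
  "('g \<Rightarrow> 'g \<Rightarrow> 'g) \<Rightarrow> ('g \<Rightarrow> 'm \<Rightarrow> 'm::ab_group_add)
    \<Rightarrow> ('g list \<Rightarrow> 'm) \<Rightarrow> 'g list \<Rightarrow> 'm" where
  "CE_diff br act f xs =
     (\<Sum>i<length xs. act (xs ! i) (f (omit i xs))) +
     (\<Sum>j<length xs. \<Sum>i<j. f (br (xs ! i) (xs ! j) # omit i (omit j xs)))"

text \<open>In the Leibniz case, the right action has been replaced by the left action, which it equals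
  on a symmetric bimodule.\<close>

definition Leibniz_diff ::
  "('g \<Rightarrow> 'g \<Rightarrow> 'g) \<Rightarrow> ('g \<Rightarrow> 'm \<Rightarrow> 'm::ab_group_add)
    \<Rightarrow> ('g list \<Rightarrow> 'm) \<Rightarrow> 'g list \<Rightarrow> 'm" where
  "Leibniz_diff br act f xs =
     (\<Sum>i<length xs. act (xs ! i) (f (omit i xs))) +
     (\<Sum>j<length xs. \<Sum>i<j. f (omit i (xs[j := br (xs ! i) (xs ! j)])))"

definition cocycles ::
  "(nat \<Rightarrow> ('g list \<Rightarrow> 'm::ab_group_add) set) \<Rightarrow> (('g list \<Rightarrow> 'm) \<Rightarrow> 'g list \<Rightarrow> 'm)
    \<Rightarrow> nat \<Rightarrow> ('g list \<Rightarrow> 'm) set" where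
  "cocycles C d n = {f \<in> C n. \<forall>xs. d f xs = 0}"

definition coboundaries ::
  "(nat \<Rightarrow> ('g list \<Rightarrow> 'm::ab_group_add) set) \<Rightarrow> (('g list \<Rightarrow> 'm) \<Rightarrow> 'g list \<Rightarrow> 'm)
    \<Rightarrow> nat \<Rightarrow> ('g list \<Rightarrow> 'm) set" where
  "coboundaries C d n = (case n of 0 \<Rightarrow> {\<lambda>_. 0} | Suc k \<Rightarrow> d ` C k)"

text \<open>The underlying set of the quotient of cocycles by coboundaries: the set of all cosets.
  Its zero element is the coset of coboundaries.\<close>

definition cohomology ::
  "(nat \<Rightarrow> ('g list \<Rightarrow> 'm::ab_group_add) set) \<Rightarrow> (('g list \<Rightarrow> 'm) \<Rightarrow> 'g list \<Rightarrow> 'm)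
    \<Rightarrow> nat \<Rightarrow> ('g list \<Rightarrow> 'm) set set" where
  "cohomology C d n =
     (\<lambda>f. {\<lambda>xs. f xs + b xs | b. b \<in> coboundaries C d n}) ` cocycles C d n"

definition cohomology_vanishes ::
  "(nat \<Rightarrow> ('g list \<Rightarrow> 'm::ab_group_add) set) \<Rightarrow> (('g list \<Rightarrow> 'm) \<Rightarrow> 'g list \<Rightarrow> 'm)
    \<Rightarrow> nat \<Rightarrow> bool" where
  "cohomology_vanishes C d n \<longleftrightarrow> cohomology C d n = {coboundaries C d n}"

end

theory Submission
  imports Defs
begin

text \<open>
  Let \<open>x\<close> be the generator of the ideal that acts as the identity, and write \<open>[y, x] = c x\<close>. The
  action of \<open>[y, x]\<close> is the commutator of the actions of \<open>y\<close> and \<open>x\<close>, which is zero because the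
  identity commutes with everything; on the other hand it is multiplication by \<open>c\<close>. As the module
  is nonzero, \<open>c = 0\<close>: the element \<open>x\<close> is central.

  Now consider the insertion operator that sends a cochain \<open>f\<close> to \<open>\<lambda>ys. f (x # ys)\<close>. By Cartan's
  formula, its anticommutator with the differential is the operator by which \<open>x\<close> acts on cochains.
  Since \<open>x\<close> is central, only the action on the values contributes to this operator, and \<open>x\<close> acts on
  the values as the identity. Thus insertion of \<open>x\<close> is a contracting homotopy in all three complexes,
  and every cocycle \<open>f\<close> is the coboundary of \<open>\<lambda>ys. f (x # ys)\<close>.

  For Leibniz cochains, Cartan's formula only regroups the terms of the differential
  (\<open>Leibniz_Cartan_formula\<close>). In the Chevalley-Eilenberg formula a bracket stands in front of the
  inserted \<open>x\<close>, and the two have to be exchanged (\<open>CE_Cartan_formula\<close>), which alternating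
  cochains permit as well as symmetric ones, because signs do not matter in characteristic \<open>2\<close>.
\<close>

section \<open>Contracting homotopies given by insertion\<close>

text \<open>
  At a cocycle \<open>f\<close> the left-hand side of the homotopy formula vanishes, which makes \<open>f\<close> the coboundary
  of its own insertion, as \<open>v + v = 0\<close> allows moving summands across the equation. In degree \<open>0\<close> the
  insertion is zero, so that the formula forces \<open>f\<close> itself to vanish there.
\<close>

lemma cohomology_vanishes_if_insertion_contracts:
  fixes C :: "nat \<Rightarrow> ('g list \<Rightarrow> 'm::ab_group_add) set"
  assumes double: "\<And>v::'m. v + v = 0"
    and C_zero: "\<And>n. (\<lambda>_. 0) \<in> C n"
    and C_add: "\<And>n f g. f \<in> C n \<Longrightarrow> g \<in> C n \<Longrightarrow> (\<lambda>xs. f xs + g xs) \<in> C n"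
    and d_zero: "d (\<lambda>_. 0) = (\<lambda>_. 0)"
    and d_add: "\<And>f g. d (\<lambda>xs. f xs + g xs) = (\<lambda>xs. d f xs + d g xs)"
    and insert_C: "\<And>n f. f \<in> C (Suc n) \<Longrightarrow> (\<lambda>ys. f (x # ys)) \<in> C n"
    and insert_0: "\<And>f. f \<in> C 0 \<Longrightarrow> (\<lambda>ys. f (x # ys)) = (\<lambda>_. 0)"
    and homotopy: "\<And>n f ys. f \<in> C n \<Longrightarrow> d f (x # ys) = f ys + d (\<lambda>zs. f (x # zs)) ys"
  shows "cohomology_vanishes C d n"
proof -
  let ?B = "coboundaries C d n"
  have cocycle_boundary: "f \<in> ?B" if "f \<in> cocycles C d n" for f
  proof -
    have fC: "f \<in> C n" and df: "\<And>xs. d f xs = 0"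
      using that by (auto simp: cocycles_def)
    have "f ys + d (\<lambda>zs. f (x # zs)) ys = 0" for ys
      using homotopy[OF fC, of ys] df[of "x # ys"] by simp
    then have "f ys = d (\<lambda>zs. f (x # zs)) ys" for ys
      by (metis add_right_cancel double)
    then have f_eq: "f = d (\<lambda>zs. f (x # zs))"
      by (rule ext)
    show ?thesis
    proof (cases n)
      case 0
      with fC f_eq insert_0 d_zero have "f = (\<lambda>_. 0)"
        by metis
      with 0 show ?thesis
        by (simp add: coboundaries_def)
    next
      case (Suc k)
      with fC f_eq insert_C show ?thesis
        by (auto simp: coboundaries_def)
    qed
  qed
  have B_add: "(\<lambda>xs. a xs + b xs) \<in> ?B" if "a \<in> ?B" "b \<in> ?B" for a b
  proof (cases n)
    case 0
    with that show ?thesis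
      by (simp add: coboundaries_def)
  next
    case (Suc k)
    with that obtain a' b' where "a = d a'" "a' \<in> C k" "b = d b'" "b' \<in> C k"
      by (auto simp: coboundaries_def)
    then show ?thesis
      using Suc C_add[of a' k b'] d_add[of a' b']
      by (auto simp: coboundaries_def intro: rev_image_eqI)
  qed
  have coset: "{\<lambda>xs. f xs + b xs | b. b \<in> ?B} = ?B" if f: "f \<in> cocycles C d n" for f
  proof
    show "{\<lambda>xs. f xs + b xs | b. b \<in> ?B} \<subseteq> ?B"
      using B_add cocycle_boundary[OF f] by blast
    show "?B \<subseteq> {\<lambda>xs. f xs + b xs | b. b \<in> ?B}"
    proof
      fix b assume "b \<in> ?B"
      then have "(\<lambda>xs. f xs + b xs) \<in> ?B"
        using B_add cocycle_boundary[OF f] by blast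
      moreover have "b = (\<lambda>xs. f xs + (f xs + b xs))"
        by (simp add: add.assoc[symmetric] double)
      ultimately show "b \<in> {\<lambda>xs. f xs + b xs | b. b \<in> ?B}"
        by (intro CollectI exI[of _ "\<lambda>xs. f xs + b xs"] conjI)
    qed
  qed
  have "(\<lambda>_. 0) \<in> cocycles C d n"
    using C_zero d_zero by (simp add: cocycles_def)
  moreover have "cohomology C d n = (\<lambda>_. ?B) ` cocycles C d n"
    unfolding cohomology_def by (rule image_cong[OF refl coset])
  ultimately show ?thesis
    unfolding cohomology_vanishes_def by auto
qed

section \<open>Inserting an argument into a cochain\<close>

lemma omit_Cons_0 [simp]: "omit 0 (x # xs) = xs"
  by (simp add: omit_def)

lemma omit_Cons_Suc [simp]: "omit (Suc i) (x # xs) = x # omit i xs"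
  by (simp add: omit_def)

lemma symmetric_is_tensor_cochain:
  "f \<in> symmetric_cochains sg sm n \<Longrightarrow> f \<in> tensor_cochains sg sm n"
  by (simp add: symmetric_cochains_def)

lemma alternating_is_tensor_cochain:
  "f \<in> alternating_cochains sg sm n \<Longrightarrow> f \<in> tensor_cochains sg sm n"
  by (simp add: alternating_cochains_def)

lemma tensor_cochain_length: "f \<in> tensor_cochains sg sm n \<Longrightarrow> length xs \<noteq> n \<Longrightarrow> f xs = 0"
  by (simp add: tensor_cochains_def)

lemma tensor_cochain_linear:
  "f \<in> tensor_cochains sg sm n \<Longrightarrow> length xs = n \<Longrightarrow> i < n
    \<Longrightarrow> Vector_Spaces.linear sg sm (\<lambda>y. f (xs[i := y]))"
  by (simp add: tensor_cochains_def)

lemma linear_zero_arg: "Vector_Spaces.linear s t f \<Longrightarrow> f 0 = 0"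
  by (rule module_hom.zero[OF module_hom_linearI])

lemma linear_add_arg: "Vector_Spaces.linear s t f \<Longrightarrow> f (a + b) = f a + f b"
  by (rule module_hom.add[OF module_hom_linearI])

lemma tensor_cochain_update_zero:
  assumes f: "f \<in> tensor_cochains sg sm n" and j: "j < length xs"
  shows "f (xs[j := 0]) = 0"
proof (cases "length xs = n")
  case True
  with j show ?thesis
    using linear_zero_arg[OF tensor_cochain_linear[OF f True, of j]] by simp
qed (simp add: tensor_cochain_length[OF f])

lemma tensor_cochain_zero_head:
  "f \<in> tensor_cochains sg sm n \<Longrightarrow> f (0 # zs) = 0"
  using tensor_cochain_update_zero[of f sg sm n 0 "0 # zs"] by simp

lemma tensor_cochains_insert:
  assumes f: "f \<in> tensor_cochains sg sm (Suc n)"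
  shows "(\<lambda>ys. f (x # ys)) \<in> tensor_cochains sg sm n"
proof -
  have "Vector_Spaces.linear sg sm (\<lambda>y. f (x # ys[i := y]))" if "length ys = n" "i < n" for ys i
    using tensor_cochain_linear[OF f, of "x # ys" "Suc i"] that by simp
  then show ?thesis
    using tensor_cochain_length[OF f] by (simp add: tensor_cochains_def)
qed

lemma symmetric_cochains_insert:
  "f \<in> symmetric_cochains sg sm (Suc n) \<Longrightarrow> (\<lambda>ys. f (x # ys)) \<in> symmetric_cochains sg sm n"
  using tensor_cochains_insert[of f sg sm n x] by (simp add: symmetric_cochains_def)

lemma alternating_cochains_insert:
  "f \<in> alternating_cochains sg sm (Suc n) \<Longrightarrow> (\<lambda>ys. f (x # ys)) \<in> alternating_cochains sg sm n"
  using tensor_cochains_insert[of f sg sm n x] by (simp add: alternating_cochains_def)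

lemma symmetric_cochain_swap: "f \<in> symmetric_cochains sg sm n \<Longrightarrow> f (a # b # zs) = f (b # a # zs)"
  by (simp add: symmetric_cochains_def)

text \<open>
  Expanding the vanishing value of \<open>f\<close> at a repeated argument \<open>a + b\<close> shows that \<open>f\<close> is
  antisymmetric, which in characteristic \<open>2\<close> is the same as symmetric.
\<close>

lemma alternating_cochain_swap:
  fixes f :: "'g::ab_group_add list \<Rightarrow> 'm::ab_group_add"
  assumes double: "\<And>v::'m. v + v = 0" and f: "f \<in> alternating_cochains sg sm n"
  shows "f (a # b # zs) = f (b # a # zs)"
proof (cases "length (a # b # zs) = n")
  case True
  have ft: "f \<in> tensor_cochains sg sm n"
    using f by (rule alternating_is_tensor_cochain)
  have repeated: "f (c # c # zs) = 0" for c
    using f by (simp add: alternating_cochains_def)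
  have add_fst: "f ((c + c') # e # zs) = f (c # e # zs) + f (c' # e # zs)" for c c' e
    using linear_add_arg[OF tensor_cochain_linear[OF ft, of "c # e # zs" 0]] True by simp
  have add_snd: "f (e # (c + c') # zs) = f (e # c # zs) + f (e # c' # zs)" for c c' e
    using linear_add_arg[OF tensor_cochain_linear[OF ft, of "e # c # zs" 1]] True by simp
  have "f ((a + b) # (a + b) # zs) =
      f (a # a # zs) + f (a # b # zs) + (f (b # a # zs) + f (b # b # zs))"
    by (simp only: add_fst add_snd ac_simps)
  then have "f (a # b # zs) + f (b # a # zs) = f (b # a # zs) + f (b # a # zs)"
    by (simp add: repeated double)
  then show ?thesis
    by simp
next
  case False
  then show ?thesis
    using tensor_cochain_length[OF alternating_is_tensor_cochain[OF f]] by simp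
qed

section \<open>Cartan's formula for a central element acting as the identity\<close>

text \<open>
  The terms of \<open>d f (x # ys)\<close> are sorted by whether they touch the position of \<open>x\<close>. Those that do
  are the action of \<open>x\<close> on \<open>f ys\<close> and the brackets \<open>[x, y]\<close>, which vanish. In the others \<open>x\<close> is a mere
  parameter, but it comes second after a bracket, and \<open>swap\<close> moves it to the front.
\<close>

lemma CE_Cartan_formula:
  assumes f: "f \<in> tensor_cochains sg sm n"
    and swap: "\<And>a b zs. f (a # b # zs) = f (b # a # zs)"
    and central: "\<And>y. br x y = 0"
    and act_id: "\<And>v. act x v = v"
  shows "CE_diff br act f (x # ys) = f ys + CE_diff br act (\<lambda>zs. f (x # zs)) ys"
  by (simp add: CE_diff_def sum.lessThan_Suc_shift central act_id
      tensor_cochain_zero_head[OF f] swap[of _ x] add.assoc del: sum.lessThan_Suc)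

text \<open>
  A Leibniz bracket takes the place of its right factor, so that \<open>x\<close> stays in front whenever it is not
  itself in the bracket, and the terms match one by one.
\<close>

lemma Leibniz_Cartan_formula:
  assumes f: "f \<in> tensor_cochains sg sm n"
    and central: "\<And>y. br x y = 0"
    and act_id: "\<And>v. act x v = v"
  shows "Leibniz_diff br act f (x # ys) = f ys + Leibniz_diff br act (\<lambda>zs. f (x # zs)) ys"
  by (simp add: Leibniz_diff_def sum.lessThan_Suc_shift central act_id
      tensor_cochain_update_zero[OF f] add.assoc del: sum.lessThan_Suc)

section \<open>Vanishing of the three cohomologies\<close>

context char2_lie_module
begin

lemma one_plus_one_zero: "(1 + 1 :: 'k) = 0"
  using of_nat_CHAR[where 'a='k] by (simp add: char2)

lemma double_zero: "(v::'m) + v = 0"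
  using mod.scale_left_distrib[of 1 1 v] by (simp add: one_plus_one_zero del: one_add_one)

lemma act_zero: "act y 0 = 0"
  using linear_zero_arg[OF act_linear_right] .

lemma act_add: "act y (v + w) = act y v + act y w"
  using linear_add_arg[OF act_linear_right] .

lemma CE_diff_zero: "CE_diff br act (\<lambda>_. 0) = (\<lambda>_. 0)"
  by (rule ext) (simp add: CE_diff_def act_zero)

lemma CE_diff_add:
  "CE_diff br act (\<lambda>xs. f xs + g xs) = (\<lambda>xs. CE_diff br act f xs + CE_diff br act g xs)"
  by (rule ext) (simp add: CE_diff_def act_add sum.distrib algebra_simps)

lemma Leibniz_diff_zero: "Leibniz_diff br act (\<lambda>_. 0) = (\<lambda>_. 0)"
  by (rule ext) (simp add: Leibniz_diff_def act_zero)

lemma Leibniz_diff_add: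
  "Leibniz_diff br act (\<lambda>xs. f xs + g xs) =
    (\<lambda>xs. Leibniz_diff br act f xs + Leibniz_diff br act g xs)"
  by (rule ext) (simp add: Leibniz_diff_def act_add sum.distrib algebra_simps)

lemma tensor_cochains_zero: "(\<lambda>_. 0) \<in> tensor_cochains sg sm n"
  by (simp add: tensor_cochains_def vector_space_pair.linear_zero vector_space_pair_def
      vector_space_axioms mod.vector_space_axioms)

lemma symmetric_cochains_zero: "(\<lambda>_. 0) \<in> symmetric_cochains sg sm n"
  by (simp add: symmetric_cochains_def tensor_cochains_zero)

lemma alternating_cochains_zero: "(\<lambda>_. 0) \<in> alternating_cochains sg sm n"
  by (simp add: alternating_cochains_def tensor_cochains_zero)

lemma tensor_cochains_add:
  "f \<in> tensor_cochains sg sm n \<Longrightarrow> g \<in> tensor_cochains sg sm n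
    \<Longrightarrow> (\<lambda>xs. f xs + g xs) \<in> tensor_cochains sg sm n"
  by (simp add: tensor_cochains_def vector_space_pair.linear_compose_add vector_space_pair_def
      vector_space_axioms mod.vector_space_axioms)

lemma symmetric_cochains_add:
  "f \<in> symmetric_cochains sg sm n \<Longrightarrow> g \<in> symmetric_cochains sg sm n
    \<Longrightarrow> (\<lambda>xs. f xs + g xs) \<in> symmetric_cochains sg sm n"
  unfolding symmetric_cochains_def
  by (intro CollectI conjI allI impI tensor_cochains_add arg_cong2[where f = "(+)"]) blast+

lemma alternating_cochains_add:
  "f \<in> alternating_cochains sg sm n \<Longrightarrow> g \<in> alternating_cochains sg sm n
    \<Longrightarrow> (\<lambda>xs. f xs + g xs) \<in> alternating_cochains sg sm n"
  by (simp add: alternating_cochains_def tensor_cochains_add)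

text \<open>
  On a nonzero module, the scalar \<open>c\<close> in \<open>[y, x] = c x\<close> can be read off from the action of
  \<open>[y, x]\<close>, which is zero because the identity commutes with the action of \<open>y\<close>.
\<close>

lemma ideal_generator_acting_as_identity_is_central:
  assumes ideal: "lie_ideal sg br (span {x})"
    and act_id: "\<And>v. act x v = v"
    and nonzero: "(v::'m) \<noteq> 0"
  shows "br x y = 0"
proof -
  have sym: "br a b = br b a" for a b
  proof -
    have "br (a + b) (a + b) = br a a + br a b + (br b a + br b b)"
      by (simp only: linear_add_arg[OF br_linear_left] linear_add_arg[OF br_linear_right] ac_simps)
    then have "br a b + br b a = 0"
      by (simp add: br_self)
    moreover have "br b a + br b a = 0"
      using scale_left_distrib[of 1 1 "br b a"] by (simp add: one_plus_one_zero del: one_add_one)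
    ultimately show ?thesis
      by (metis add_right_cancel)
  qed
  have "br y x \<in> span {x}"
    using ideal by (simp add: lie_ideal_def span_base)
  then obtain c where c: "br y x = sg c x"
    by (auto simp: span_singleton)
  have "sm c v = act (br y x) v"
    using module_hom.scale[OF module_hom_linearI[OF act_linear_left]] by (simp add: c act_id)
  also have "\<dots> = 0"
    by (simp add: act_br act_id double_zero)
  finally have "c = 0"
    using nonzero by simp
  with c sym show ?thesis
    by simp
qed

theorem cohomologies_vanish_if_central_acts_as_identity:
  assumes central: "\<And>y. br x y = 0"
    and act_id: "\<And>v. act x v = v"
  shows "cohomology_vanishes (symmetric_cochains sg sm) (CE_diff br act) n"
    and "cohomology_vanishes (tensor_cochains sg sm) (Leibniz_diff br act) n"
    and "cohomology_vanishes (alternating_cochains sg sm) (CE_diff br act) n"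
proof -
  have insert_0: "(\<lambda>ys. f (x # ys)) = (\<lambda>_. 0)" if "f \<in> tensor_cochains sg sm 0" for f
    using tensor_cochain_length[OF that] by simp
  show "cohomology_vanishes (symmetric_cochains sg sm) (CE_diff br act) n"
  proof (rule cohomology_vanishes_if_insertion_contracts[where x = x
        and C = "symmetric_cochains sg sm" and d = "CE_diff br act",
        OF double_zero symmetric_cochains_zero symmetric_cochains_add CE_diff_zero CE_diff_add])
    fix m and f :: "'g list \<Rightarrow> 'm"
    assume "f \<in> symmetric_cochains sg sm (Suc m)"
    then show "(\<lambda>ys. f (x # ys)) \<in> symmetric_cochains sg sm m"
      by (rule symmetric_cochains_insert)
  next
    fix f :: "'g list \<Rightarrow> 'm"
    assume "f \<in> symmetric_cochains sg sm 0"
    then show "(\<lambda>ys. f (x # ys)) = (\<lambda>_. 0)"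
      by (rule insert_0[OF symmetric_is_tensor_cochain])
  next
    fix m ys and f :: "'g list \<Rightarrow> 'm"
    assume f: "f \<in> symmetric_cochains sg sm m"
    from symmetric_is_tensor_cochain[OF f]
    show "CE_diff br act f (x # ys) = f ys + CE_diff br act (\<lambda>zs. f (x # zs)) ys"
      using symmetric_cochain_swap[OF f] central act_id by (rule CE_Cartan_formula)
  qed
  show "cohomology_vanishes (tensor_cochains sg sm) (Leibniz_diff br act) n"
  proof (rule cohomology_vanishes_if_insertion_contracts[where x = x
        and C = "tensor_cochains sg sm" and d = "Leibniz_diff br act",
        OF double_zero tensor_cochains_zero tensor_cochains_add Leibniz_diff_zero Leibniz_diff_add])
    fix m and f :: "'g list \<Rightarrow> 'm"
    assume "f \<in> tensor_cochains sg sm (Suc m)"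
    then show "(\<lambda>ys. f (x # ys)) \<in> tensor_cochains sg sm m"
      by (rule tensor_cochains_insert)
  next
    fix f :: "'g list \<Rightarrow> 'm"
    assume "f \<in> tensor_cochains sg sm 0"
    then show "(\<lambda>ys. f (x # ys)) = (\<lambda>_. 0)"
      by (rule insert_0)
  next
    fix m ys and f :: "'g list \<Rightarrow> 'm"
    assume f: "f \<in> tensor_cochains sg sm m"
    then show "Leibniz_diff br act f (x # ys) = f ys + Leibniz_diff br act (\<lambda>zs. f (x # zs)) ys"
      using central act_id by (rule Leibniz_Cartan_formula)
  qed
  show "cohomology_vanishes (alternating_cochains sg sm) (CE_diff br act) n"
  proof (rule cohomology_vanishes_if_insertion_contracts[where x = x
        and C = "alternating_cochains sg sm" and d = "CE_diff br act",
        OF double_zero alternating_cochains_zero alternating_cochains_add CE_diff_zero CE_diff_add])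
    fix m and f :: "'g list \<Rightarrow> 'm"
    assume "f \<in> alternating_cochains sg sm (Suc m)"
    then show "(\<lambda>ys. f (x # ys)) \<in> alternating_cochains sg sm m"
      by (rule alternating_cochains_insert)
  next
    fix f :: "'g list \<Rightarrow> 'm"
    assume "f \<in> alternating_cochains sg sm 0"
    then show "(\<lambda>ys. f (x # ys)) = (\<lambda>_. 0)"
      by (rule insert_0[OF alternating_is_tensor_cochain])
  next
    fix m ys and f :: "'g list \<Rightarrow> 'm"
    assume f: "f \<in> alternating_cochains sg sm m"
    from alternating_is_tensor_cochain[OF f]
    show "CE_diff br act f (x # ys) = f ys + CE_diff br act (\<lambda>zs. f (x # zs)) ys"
      using alternating_cochain_swap[OF double_zero f] central act_id by (rule CE_Cartan_formula)
  qed
qed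

end

theorem theorem6p4:
  fixes sg :: "'k::field \<Rightarrow> 'g::ab_group_add \<Rightarrow> 'g"
    and br :: "'g \<Rightarrow> 'g \<Rightarrow> 'g"
    and sm :: "'k \<Rightarrow> 'm::ab_group_add \<Rightarrow> 'm"
    and act :: "'g \<Rightarrow> 'm \<Rightarrow> 'm"
    and h :: "'g set"
  assumes "CHAR('k) = 2"
    and "char2_lie_algebra sg br"
    and "lie_ideal sg br h"
    and "vector_space.dim sg h = 1"
    and "char2_lie_module sg br sm act"
    and "vector_space.dim sm (UNIV :: 'm set) = 1"
    and "\<exists>x. module.span sg {x} = h \<and> (\<forall>v. act x v = v)"
  shows "\<forall>n. cohomology_vanishes (symmetric_cochains sg sm) (CE_diff br act) n
           \<and> cohomology_vanishes (tensor_cochains sg sm) (Leibniz_diff br act) n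
           \<and> cohomology_vanishes (alternating_cochains sg sm) (CE_diff br act) n"
proof -
  interpret char2_lie_module sg br sm act
    by fact
  obtain x where x: "module.span sg {x} = h" and act_id: "\<And>v. act x v = v"
    using assms(7) by blast
  have "\<exists>v::'m. v \<noteq> 0"
  proof (rule ccontr)
    assume "\<not> ?thesis"
    then have "(UNIV :: 'm set) = {0}"
      by auto
    then have "mod.dim (UNIV :: 'm set) = 0"
      using mod.dim_span[of "{}"] mod.dim_eq_card_independent[OF mod.independent_empty] by simp
    with assms(6) show False
      by simp
  qed
  then obtain v :: 'm where "v \<noteq> 0"
    by blast
  then have "br x y = 0" for y
    using ideal_generator_acting_as_identity_is_central[of x v y] assms(3) x act_id by simp
  then show ?thesis
    using cohomologies_vanish_if_central_acts_as_identity[of x] act_id by blast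
qed

end
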